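(* Let $\mathfrak{g}=\mathfrak{g}_{3.3}\oplus\mathfrak{g}_1$ be the four-dimensional real Lie algebra with basis $\mathcal{B}=\{e_1,e_2,e_3,e_4\}$ whose nonzero Lie brackets (up to skew-symmetry) are $[e_2,e_3]=-e_2$, $[e_3,e_1]=e_1$. Let $\langle\cdot,\cdot\rangle$ be a pseudo-Riemannian inner product on $\mathfrak{g}$ and let $(R_{ij})$ be the matrix of its Ricci operator $\operatorname{Ric}$ in the basis $\mathcal{B}$. If $$R_{31}=R_{41}=R_{32}=R_{42}=R_{14}=R_{24}=R_{34}=0,$$ then $\langle\cdot,\cdot\rangle$ is an algebraic Ricci soliton. In this case, $\operatorname{Ric}=\eta I_4+D$ where $\eta=R_{33}$ and $$D=\begin{bmatrix}R_{11}-R_{33}&R_{12}&R_{13}&0\\R_{21}&R_{22}-R_{33}&R_{23}&0\\0&0&0&0\\0&0&R_{43}&R_{44}-R_{33}\end{bmatrix}$$ is (the matrix in the basis $\mathcal{B}$ of) a derivation of $\mathfrak{g}$.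
   Context: A pseudo-Riemannian inner product on a real Lie algebra $\mathfrak{g}$ is a nondegenerate symmetric bilinear form $\langle\cdot,\cdot\rangle$ on $\mathfrak{g}$ (of some signature $(r,s)$). Its Levi-Civita connection $\nabla$ is defined by $2\langle\nabla_uv,w\rangle=\langle[u,v],w\rangle+\langle[w,u],v\rangle+\langle[w,v],u\rangle$; its curvature is $R_{uv}=\nabla_{[u,v]}-[\nabla_u,\nabla_v]$; its Ricci curvature $\operatorname{ric}(u,v)$ is the trace of $w\mapsto R_{uw}v$; its Ricci operator $\operatorname{Ric}$ is the endomorphism of $\mathfrak{g}$ with $\langle\operatorname{Ric}(u),v\rangle=\operatorname{ric}(u,v)$. The matrix $(R_{ij})$ of $\operatorname{Ric}$ in a basis $\{e_i\}$ is given by $\operatorname{Ric}(e_j)=\sum_iR_{ij}e_i$ (the same column convention is used for $D$). A derivation is a linear map $D:\mathfrak{g}\to\mathfrak{g}$ with $D[x,y]=[D(x),y]+[x,D(y)]$ for all $x,y$. The inner product is an algebraic Ricci soliton if $\operatorname{Ric}=\eta\,\mathrm{Id}_{\mathfrak{g}}+D$ for some $\eta\in\mathbb{R}$ and some derivation $D$ of $\mathfrak{g}$. *)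

theory Defs
  imports "HOL-Analysis.Analysis"
begin

text \<open>Lie brackets and bilinear forms are functions on the coordinate space of column vectors,
  where the basis vector \<open>e\<^sub>i\<close> is \<^term>\<open>axis i 1\<close>.\<close>

definition lie_bracket :: "(real^'n \<Rightarrow> real^'n \<Rightarrow> real^'n) \<Rightarrow> bool" where
  "lie_bracket br \<longleftrightarrow> bilinear br \<and> (\<forall>x. br x x = 0) \<and>
     (\<forall>x y z. br x (br y z) + br y (br z x) + br z (br x y) = 0)"

definition lie_derivation ::
    "(real^'n \<Rightarrow> real^'n \<Rightarrow> real^'n) \<Rightarrow> (real^'n \<Rightarrow> real^'n) \<Rightarrow> bool" where
  "lie_derivation br D \<longleftrightarrow> linear D \<and> (\<forall>x y. D (br x y) = br (D x) y + br x (D y))"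

definition pseudo_inner_product :: "(real^'n \<Rightarrow> real^'n \<Rightarrow> real) \<Rightarrow> bool" where
  "pseudo_inner_product g \<longleftrightarrow> bilinear g \<and> (\<forall>u v. g u v = g v u) \<and>
     (\<forall>u. (\<forall>v. g u v = 0) \<longrightarrow> u = 0)"

text \<open>The two \<open>THE\<close> descriptions below are proper for nondegenerate \<open>g\<close>;
  see \<open>levi_civita_koszul\<close> and \<open>ricci_operator_ricci\<close>.\<close>

definition levi_civita :: "(real^'n \<Rightarrow> real^'n \<Rightarrow> real^'n) \<Rightarrow> (real^'n \<Rightarrow> real^'n \<Rightarrow> real) \<Rightarrow>
    real^'n \<Rightarrow> real^'n \<Rightarrow> real^'n" where
  "levi_civita br g u v =
     (THE x. \<forall>w. 2 * g x w = g (br u v) w + g (br w u) v + g (br w v) u)"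

definition curvature :: "(real^'n \<Rightarrow> real^'n \<Rightarrow> real^'n) \<Rightarrow> (real^'n \<Rightarrow> real^'n \<Rightarrow> real) \<Rightarrow>
    real^'n \<Rightarrow> real^'n \<Rightarrow> real^'n \<Rightarrow> real^'n" where
  "curvature br g u v w =
     levi_civita br g (br u v) w -
     (levi_civita br g u (levi_civita br g v w) - levi_civita br g v (levi_civita br g u w))"

definition ricci :: "(real^'n \<Rightarrow> real^'n \<Rightarrow> real^'n) \<Rightarrow> (real^'n \<Rightarrow> real^'n \<Rightarrow> real) \<Rightarrow>
    real^'n \<Rightarrow> real^'n \<Rightarrow> real" where
  "ricci br g u v = trace (matrix (\<lambda>w. curvature br g u w v))"

definition ricci_operator :: "(real^'n \<Rightarrow> real^'n \<Rightarrow> real^'n) \<Rightarrow> (real^'n \<Rightarrow> real^'n \<Rightarrow> real) \<Rightarrow>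
    real^'n \<Rightarrow> real^'n" where
  "ricci_operator br g u = (THE x. \<forall>v. g x v = ricci br g u v)"

definition algebraic_ricci_soliton ::
    "(real^'n \<Rightarrow> real^'n \<Rightarrow> real^'n) \<Rightarrow> (real^'n \<Rightarrow> real^'n \<Rightarrow> real) \<Rightarrow> bool" where
  "algebraic_ricci_soliton br g \<longleftrightarrow> pseudo_inner_product g \<and>
     (\<exists>\<eta> D. lie_derivation br D \<and> (\<forall>u. ricci_operator br g u = \<eta> *\<^sub>R u + D u))"

definition g33_g1_bracket :: "real^4 \<Rightarrow> real^4 \<Rightarrow> real^4" where
  "g33_g1_bracket x y =
     (x$2 * y$3 - x$3 * y$2) *\<^sub>R (- axis 2 1) + (x$3 * y$1 - x$1 * y$3) *\<^sub>R axis 1 1"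

lemma g33_g1_bracket_basis:
  "g33_g1_bracket (axis 2 1) (axis 3 1) = - axis 2 1"
  "g33_g1_bracket (axis 3 1) (axis 1 1) = axis 1 1"
  "g33_g1_bracket (axis 1 1) (axis 2 1) = 0"
  "g33_g1_bracket (axis i 1) (axis 4 1) = 0"
  by (simp_all add: g33_g1_bracket_def axis_def)

lemma lie_bracket_g33_g1: "lie_bracket g33_g1_bracket"
  unfolding lie_bracket_def bilinear_def linear_iff g33_g1_bracket_def
  by (auto simp: vec_eq_iff axis_def algebra_simps)

lemma pseudo_inner_product_represents:
  fixes g :: "real^'n \<Rightarrow> real^'n \<Rightarrow> real"
  assumes g: "pseudo_inner_product g" and \<phi>: "linear \<phi>"
  shows "\<exists>!x. \<forall>w. g x w = \<phi> w"
proof -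
  have bil: "bilinear g" and nd: "\<And>u. (\<forall>v. g u v = 0) \<Longrightarrow> u = 0"
    using g by (auto simp: pseudo_inner_product_def)
  define T :: "real^'n \<Rightarrow> real^'n" where "T = (\<lambda>u. \<chi> i. g u (axis i 1))"
  have lin2: "linear (g u)" for u
    using bil by (simp add: bilinear_def)
  have ext: "\<psi> = \<xi>" if "linear \<psi>" "linear \<xi>" "\<And>i. \<psi> (axis i 1) = \<xi> (axis i 1)"
    for \<psi> \<xi> :: "real^'n \<Rightarrow> real"
    using that by (intro linear_eq_stdbasis) (auto simp: Basis_vec_def)
  have T: "linear T"
    unfolding T_def linear_iff
    by (auto simp: vec_eq_iff bilinear_ladd[OF bil] bilinear_lmul[OF bil])
  have "T u = 0 \<Longrightarrow> u = 0" for u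
    using ext[OF lin2[of u] linear_zero] nd[of u] by (simp add: T_def vec_eq_iff fun_eq_iff)
  then have "inj T"
    using linear_injective_0[OF T] by auto
  then have "surj T"
    using linear_injective_imp_surjective[OF T] by simp
  then obtain x where x: "T x = (\<chi> i. \<phi> (axis i 1))"
    by (metis surjD)
  then have "g x = \<phi>"
    by (intro ext[OF lin2 \<phi>]) (simp add: T_def vec_eq_iff)
  moreover have "y = x" if "\<forall>w. g y w = \<phi> w" for y
    using nd[of "y - x"] that \<open>g x = \<phi>\<close> by (simp add: bilinear_lsub[OF bil])
  ultimately show ?thesis
    by auto
qed

context
  fixes br :: "real^'n \<Rightarrow> real^'n \<Rightarrow> real^'n" and g :: "real^'n \<Rightarrow> real^'n \<Rightarrow> real"
  assumes br: "lie_bracket br" and g: "pseudo_inner_product g"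
begin

private lemma bil: "bilinear br" "bilinear g"
  using br g by (auto simp: lie_bracket_def pseudo_inner_product_def)

private lemmas bil_simps =
  bil[THEN bilinear_ladd] bil[THEN bilinear_radd] bil[THEN bilinear_lmul] bil[THEN bilinear_rmul]

lemma levi_civita_ex1: "\<exists>!x. \<forall>w. 2 * g x w = g (br u v) w + g (br w u) v + g (br w v) u"
proof -
  have "linear (\<lambda>w. (g (br u v) w + g (br w u) v + g (br w v) u) / 2)"
    by (auto simp: linear_iff bil_simps field_simps)
  from pseudo_inner_product_represents[OF g this] show ?thesis
    by (simp add: field_simps)
qed

lemma levi_civita_koszul:
  "2 * g (levi_civita br g u v) w = g (br u v) w + g (br w u) v + g (br w v) u"
  using theI'[OF levi_civita_ex1, of u v] unfolding levi_civita_def by blast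

lemma levi_civita_unique:
  assumes "\<And>w. 2 * g x w = g (br u v) w + g (br w u) v + g (br w v) u"
  shows "levi_civita br g u v = x"
  using levi_civita_ex1[of u v] levi_civita_koszul[of u v] assms by blast

lemma bilinear_levi_civita: "bilinear (levi_civita br g)"
  unfolding bilinear_def linear_iff
  by (auto intro!: levi_civita_unique
      simp: bil_simps distrib_left levi_civita_koszul mult.left_commute[of 2])

private lemmas lc_simps =
  bilinear_ladd[OF bilinear_levi_civita] bilinear_radd[OF bilinear_levi_civita]
  bilinear_lmul[OF bilinear_levi_civita] bilinear_rmul[OF bilinear_levi_civita]

lemma linear_curvature: 
  "linear (\<lambda>u. curvature br g u v w)" "linear (\<lambda>v. curvature br g u v w)" "linear (curvature br g u v)"
  by (auto simp: linear_iff curvature_def bil_simps lc_simps algebra_simps)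

lemma bilinear_ricci: "bilinear (ricci br g)"
  unfolding bilinear_def linear_iff ricci_def trace_def matrix_def
  using linear_curvature
  by (auto simp: linear_iff sum.distrib sum_distrib_left)

lemma ricci_operator_ex1: "\<exists>!x. \<forall>v. g x v = ricci br g u v"
  using pseudo_inner_product_represents[OF g, of "ricci br g u"] bilinear_ricci
  by (simp add: bilinear_def)

lemma ricci_operator_ricci: "g (ricci_operator br g u) v = ricci br g u v"
  using theI'[OF ricci_operator_ex1, of u] unfolding ricci_operator_def by blast

lemma linear_ricci_operator: "linear (ricci_operator br g)"
proof -
  have *: "ricci_operator br g u = x" if "\<And>v. g x v = ricci br g u v" for u x
    using ricci_operator_ex1[of u] ricci_operator_ricci[of u] that by blast
  show ?thesis
    unfolding linear_iff
    by (auto intro!: * simp: bil_simps ricci_operator_ricci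
        bilinear_ladd[OF bilinear_ricci] bilinear_lmul[OF bilinear_ricci])
qed

end

end

theory Submission
  imports Defs
begin

text \<open>No curvature is computed: the zero pattern of \<open>R\<close> alone suffices. On the
  abelian plane P spanned by e1 and e2, ad e3 is the identity, and e4 is central. Hence a linear map
  that preserves P, scales e4 and sends e3 into P + span(e4) is a derivation: it commutes with ad e3
  on P, and the image of e3 acts trivially on P and e4. Subtracting \<open>R$3$3\<close> times the
  identity from \<open>R\<close> leaves such a map.\<close>

lemma vector_4:
  "(vector [w, x, y, z] :: 'a::zero^4)$1 = w"
  "(vector [w, x, y, z] :: 'a::zero^4)$2 = x"
  "(vector [w, x, y, z] :: 'a::zero^4)$3 = y"
  "(vector [w, x, y, z] :: 'a::zero^4)$4 = z"
  by (simp_all add: vector_def)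

theorem theorem3p5:
  fixes g :: "real^4 \<Rightarrow> real^4 \<Rightarrow> real" and R D :: "real^4^4" and \<eta> :: real
  assumes "pseudo_inner_product g"
    and "R = matrix (ricci_operator g33_g1_bracket g)"
    and "R$3$1 = 0" and "R$4$1 = 0" and "R$3$2 = 0" and "R$4$2 = 0"
    and "R$1$4 = 0" and "R$2$4 = 0" and "R$3$4 = 0"
    and "\<eta> = R$3$3"
    and "D = vector [vector [R$1$1 - R$3$3, R$1$2, R$1$3, 0],
                     vector [R$2$1, R$2$2 - R$3$3, R$2$3, 0],
                     vector [0, 0, 0, 0],
                     vector [0, 0, R$4$3, R$4$4 - R$3$3]]"
  shows "algebraic_ricci_soliton g33_g1_bracket g \<and>
    R = \<eta> *\<^sub>R mat 1 + D \<and>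
    (\<forall>u. ricci_operator g33_g1_bracket g u = \<eta> *\<^sub>R u + D *v u) \<and>
    lie_derivation g33_g1_bracket (\<lambda>u. D *v u)"
proof -
  let ?br = g33_g1_bracket
  \<comment> \<open>Linearity is the only property of the Ricci operator that is needed; it lets
    \<open>R\<close> stand for the operator.\<close>
  have linRic: "linear (ricci_operator ?br g)"
    using linear_ricci_operator[OF lie_bracket_g33_g1 assms(1)] .
  have R: "R = \<eta> *\<^sub>R mat 1 + D"
    \<comment> \<open>The seven vanishing entries of \<open>R\<close> are exactly the off-diagonal
      zeros of \<open>D\<close>; on the diagonal the shift by \<eta> cancels.\<close>
    using assms(3-11) by (simp add: vec_eq_iff forall_4 vector_4 mat_def)
  have Ric: "ricci_operator ?br g u = \<eta> *\<^sub>R u + D *v u" for u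
  proof -
    have "ricci_operator ?br g u = R *v u"
      using matrix_works[of "ricci_operator ?br g" u] linRic assms(2) by simp
    also have "\<dots> = \<eta> *\<^sub>R u + D *v u"
      by (simp add: R matrix_vector_mult_add_rdistrib flip: scaleR_matrix_vector_assoc)
    finally show ?thesis .
  qed
  have D: "lie_derivation ?br (\<lambda>u. D *v u)"
    \<comment> \<open>In coordinates, \<open>(D *v u)$3\<close> is 0 and \<open>u$4\<close> enters
      neither the bracket nor the first two coordinates of \<open>D *v u\<close>. The terms with
      \<open>R$1$3\<close> and \<open>R$2$3\<close> cancel between the two brackets on the
      right.\<close>
    unfolding lie_derivation_def g33_g1_bracket_def
    by (simp add: assms(11) vec_eq_iff forall_4 vector_4 matrix_vector_mult_def sum_4
        axis_def algebra_simps)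
  show ?thesis
    using assms(1) R Ric D unfolding algebraic_ricci_soliton_def by blast
qed

end
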